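(* Let $\mathcal H$ be a separable (complex) Hilbert space, let $\mathcal P$ be the set of orthogonal projections on $\mathcal H$, and let $\gamma:[a,b]\to\mathcal P$ be a piecewise $C^1$-smooth path. Then $$\arcsin(\|\gamma(b)-\gamma(a)\|)\le l_R(\gamma),\qquad\text{where}\quad l_R(\gamma)=\int_a^b\|\dot\gamma(t)\|\,dt$$ is the Riemannian length of $\gamma$.
   Context: $\mathcal P=\{P\in\mathcal L(\mathcal H)\mid P=P^*=P^2\}$, regarded as a subset of the Banach space $\mathcal L(\mathcal H)$ of bounded operators with the operator norm. A path $\gamma:[a,b]\to\mathcal P$ is piecewise $C^1$-smooth if there is a partition $a=t_0<\dots<t_n=b$ such that $\gamma|_{[t_j,t_{j+1}]}$ is $C^1$-smooth (as an $\mathcal L(\mathcal H)$-valued map, in operator norm) for all $j\in\{0,\dots,n-1\}$; in particular $\gamma$ is continuous. $\dot\gamma$ denotes the derivative (defined except possibly at finitely many points). *)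

theory Defs
  imports "HOL-Analysis.Analysis"
begin

text \<open>
  Complex inner product spaces. The inner product is antilinear in the first and linear in the
  second argument. The underlying real space carries the real part of the inner product, so that
  \<open>norm x = sqrt (Re (cinner x x))\<close> and positive definiteness are inherited from \<open>real_inner\<close>.
\<close>

class complex_inner = real_inner +
  fixes scaleC :: "complex \<Rightarrow> 'a \<Rightarrow> 'a"
    and cinner :: "'a \<Rightarrow> 'a \<Rightarrow> complex"
  assumes scaleC_add_right: "scaleC c (x + y) = scaleC c x + scaleC c y"
    and scaleC_add_left: "scaleC (c + d) x = scaleC c x + scaleC d x"
    and scaleC_scaleC: "scaleC c (scaleC d x) = scaleC (c * d) x"
    and scaleC_of_real: "scaleC (complex_of_real r) x = r *\<^sub>R x"
    and cinner_add_right: "cinner x (y + z) = cinner x y + cinner x z"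
    and cinner_scaleC_right: "cinner x (scaleC c y) = c * cinner x y"
    and cinner_commute: "cinner x y = cnj (cinner y x)"
    and Re_cinner: "Re (cinner x y) = inner x y"

class chilbert_space = complex_inner + complete_space

instantiation complex :: chilbert_space
begin
definition scaleC_complex :: "complex \<Rightarrow> complex \<Rightarrow> complex"
  where "scaleC_complex c x = c * x"
definition cinner_complex :: "complex \<Rightarrow> complex \<Rightarrow> complex"
  where "cinner_complex x y = cnj x * y"
instance
  by standard
    (auto simp: scaleC_complex_def cinner_complex_def algebra_simps scaleR_conv_of_real
      inner_complex_def)
end

text \<open>
  \<open>\<L>(\<H>)\<close> is realised as the closed subspace of complex-linear operators in the Banach space of
  bounded real-linear operators; the operator norm is the same.
\<close>

definition bounded_clinear_ops :: "('a::complex_inner \<Rightarrow>\<^sub>L 'a) set"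
  where "bounded_clinear_ops = {A. \<forall>c x. blinfun_apply A (scaleC c x) = scaleC c (blinfun_apply A x)}"

definition is_cadjoint :: "('a::complex_inner \<Rightarrow>\<^sub>L 'a) \<Rightarrow> ('a \<Rightarrow>\<^sub>L 'a) \<Rightarrow> bool"
  where "is_cadjoint B A \<longleftrightarrow> (\<forall>x y. cinner (B x) y = cinner x (A y))"

text \<open>\<open>is_cadjoint P P\<close> is \<open>P\<^sup>* = P\<close>, since adjoints are unique.\<close>

definition orthogonal_projections :: "('a::complex_inner \<Rightarrow>\<^sub>L 'a) set"
  where "orthogonal_projections =
    {P \<in> bounded_clinear_ops. is_cadjoint P P \<and> P o\<^sub>L P = P}"

text \<open>
  At the end points of an interval the derivative is one-sided, so here \<open>C\<^sup>1\<close> on each closed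
  piece is required. This is stronger than \<open>piecewise_C1_differentiable_on\<close>, which puts no
  condition on the derivative near the partition points.
\<close>

definition C1_smooth_on :: "(real \<Rightarrow> 'b::real_normed_vector) \<Rightarrow> real set \<Rightarrow> bool"
  where "C1_smooth_on f S \<longleftrightarrow>
    (\<exists>f'. (\<forall>t\<in>S. (f has_vector_derivative f' t) (at t within S)) \<and> continuous_on S f')"

definition piecewise_C1_smooth :: "real \<Rightarrow> real \<Rightarrow> (real \<Rightarrow> 'b::real_normed_vector) \<Rightarrow> bool"
  where "piecewise_C1_smooth a b f \<longleftrightarrow>
    (\<exists>(n::nat) (t::nat \<Rightarrow> real). t 0 = a \<and> t n = b \<and>
      (\<forall>j<n. t j < t (Suc j)) \<and> (\<forall>j<n. C1_smooth_on f {t j..t (Suc j)}))"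

text \<open>
  At the finitely many points where the derivative does not exist, the integrand has an
  unspecified value, which does not affect the integral.
\<close>

definition riemannian_length :: "real \<Rightarrow> real \<Rightarrow> (real \<Rightarrow> 'b::real_normed_vector) \<Rightarrow> real"
  where "riemannian_length a b f =
    integral {a..b} (\<lambda>t. norm (vector_derivative f (at t within {a..b})))"

end

theory Submission
  imports Defs
begin

text \<open>
  The angle \<open>arcsin \<parallel>P - Q\<parallel>\<close> satisfies the triangle inequality on projections: a vector in the
  range of \<open>P\<close> makes with its image under \<open>Q\<close> an angle at most \<open>arcsin \<parallel>P - Q\<parallel>\<close>, and angles
  between vectors add up. Along a fine partition of the path the angles of consecutive projections
  are at most \<open>1 + \<epsilon>\<close> times the increments of the arc length, because \<open>arcsin\<close> has slope \<open>1\<close>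
  at \<open>0\<close>.
\<close>

section \<open>The angle between projections\<close>

lemma projection_idem:
  assumes "P \<in> orthogonal_projections"
  shows "blinfun_apply P (P x) = P x"
proof -
  have "P o\<^sub>L P = P"
    using assms by (simp add: orthogonal_projections_def)
  then show ?thesis
    by (metis blinfun_apply_blinfun_compose)
qed

lemma projection_inner:
  assumes "P \<in> orthogonal_projections"
  shows "inner (blinfun_apply P x) y = inner x (P y)"
proof -
  have "cinner (P x) y = cinner x (P y)"
    using assms by (simp add: orthogonal_projections_def is_cadjoint_def)
  then show ?thesis
    by (metis Re_cinner)
qed

lemma projection_inner_self:
  assumes "P \<in> orthogonal_projections"
  shows "inner (blinfun_apply P x) x = (norm (P x))\<^sup>2"
  by (metis assms power2_norm_eq_inner projection_idem projection_inner)

lemma projection_pythagoras: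
  assumes "P \<in> orthogonal_projections"
  shows "(norm x)\<^sup>2 = (norm (blinfun_apply P x))\<^sup>2 + (norm (x - P x))\<^sup>2"
  using projection_inner_self[OF assms, of x]
  by (simp add: power2_norm_eq_inner inner_diff inner_commute)

lemma norm_projection_complement_le:
  assumes "P \<in> orthogonal_projections"
  shows "norm (x - blinfun_apply P x) \<le> norm x"
proof (rule power2_le_imp_le)
  show "(norm (x - P x))\<^sup>2 \<le> (norm x)\<^sup>2"
    using projection_pythagoras[OF assms, of x] by simp
qed simp

text \<open>Splitting \<open>(P - Q) x\<close> as \<open>P (x - Q x)\<close> minus
  \<open>Q x - P (Q x)\<close> gives two orthogonal vectors, one in the range of \<open>P\<close>
  and one in its kernel. Their inputs \<open>x - Q x\<close> and \<open>Q x\<close> are orthogonal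
  as well, so bounding each piece by the factor \<open>s\<close> bounds the whole. This reduces an
  operator norm to two distance estimates for vectors in the ranges.\<close>

lemma norm_projection_diff_le:
  assumes P: "P \<in> orthogonal_projections" and Q: "Q \<in> orthogonal_projections"
    and s: "0 \<le> s"
    and PQ: "\<And>x. blinfun_apply P x = x \<Longrightarrow> norm (x - blinfun_apply Q x) \<le> s * norm x"
    and QP: "\<And>x. blinfun_apply Q x = x \<Longrightarrow> norm (x - blinfun_apply P x) \<le> s * norm x"
  shows "norm (P - Q) \<le> s"
proof (rule norm_blinfun_bound[OF s])
  fix x
  define w where "w = x - Q x"
  define u where "u = P w"
  define v where "v = Q x - P (Q x)"
  have Qw: "Q w = 0" and Pv: "P v = 0" and Pu: "P u = u"
    by (simp_all add: w_def v_def u_def blinfun.diff_right projection_idem P Q)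
  have diff: "(P - Q) x = u - v"
    by (simp add: u_def v_def w_def blinfun.diff_right blinfun.diff_left)
  have "inner u v = 0"
    by (metis P Pu Pv inner_zero_right projection_inner)
  then have "(norm (u - v))\<^sup>2 = (norm u)\<^sup>2 + (norm v)\<^sup>2"
    by (simp add: power2_norm_eq_inner inner_diff inner_commute)
  \<comment> \<open>\<open>P (1 - Q)\<close> is the adjoint of \<open>(1 - Q) P\<close>, so it inherits the bound of the latter.\<close>
  have "(norm u)\<^sup>2 = inner u w"
    using projection_inner_self[OF P, of w] by (simp add: u_def)
  also have "\<dots> = inner (u - Q u) w"
    by (simp add: inner_diff_left projection_inner[OF Q] Qw)
  also have "\<dots> \<le> norm (u - Q u) * norm w"
    by (rule norm_cauchy_schwarz)
  also have "\<dots> \<le> s * norm u * norm w"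
    by (intro mult_right_mono PQ Pu norm_ge_zero)
  finally have "norm u * norm u \<le> norm u * (s * norm w)"
    by (simp add: power2_eq_square mult_ac)
  then have u: "norm u \<le> s * norm w"
    using s by (cases "u = 0") auto
  have v: "norm v \<le> s * norm (Q x)"
    unfolding v_def by (rule QP) (rule projection_idem[OF Q])
  have "(norm (u - v))\<^sup>2 = (norm u)\<^sup>2 + (norm v)\<^sup>2" by fact
  also have "\<dots> \<le> (s * norm w)\<^sup>2 + (s * norm (Q x))\<^sup>2"
    using u v by (intro add_mono power_mono) auto
  also have "\<dots> = (s * norm x)\<^sup>2"
    using projection_pythagoras[OF Q, of x] by (simp add: w_def power_mult_distrib algebra_simps)
  finally show "norm ((P - Q) x) \<le> s * norm x"
    unfolding diff by (rule power2_le_imp_le) (simp add: s)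
qed

text \<open>Keeps every distance between projections inside the domain of
  \<open>arcsin\<close>.\<close>

lemma norm_projection_diff_le_1:
  assumes "P \<in> orthogonal_projections" "Q \<in> orthogonal_projections"
  shows "norm (P - Q) \<le> 1"
  by (rule norm_projection_diff_le) (simp_all add: assms norm_projection_complement_le)

text \<open>Passes from the sine form of an angle bound (distance to the range) to the cosine form
  (length of the projected vector), by Pythagoras.\<close>

lemma projection_angle_bound_cos:
  assumes P: "P \<in> orthogonal_projections" and \<alpha>: "0 \<le> \<alpha>" "\<alpha> \<le> pi / 2"
    and "norm (x - blinfun_apply P x) \<le> sin \<alpha> * norm x"
  shows "cos \<alpha> * norm x \<le> norm (blinfun_apply P x)"
proof (rule power2_le_imp_le)
  have "(norm (x - P x))\<^sup>2 \<le> (sin \<alpha> * norm x)\<^sup>2"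
    using assms by (intro power_mono) auto
  then show "(cos \<alpha> * norm x)\<^sup>2 \<le> (norm (P x))\<^sup>2"
    using projection_pythagoras[OF P, of x]
    by (simp add: power_mult_distrib cos_squared_eq algebra_simps)
qed simp

text \<open>Addition of angles along the chain \<open>x\<close>, \<open>y = Q x\<close>,
  \<open>z = R y\<close>. As \<open>z\<close> lies in the range of \<open>R\<close>, the length of
  \<open>R x\<close> is at least the component of \<open>x\<close> along \<open>z\<close>. In that
  component \<open>y\<close> contributes \<open>norm z\<close>, while \<open>x - y\<close>, being
  orthogonal to \<open>y\<close>, can only meet the part of \<open>z\<close> orthogonal to
  \<open>y\<close>. The addition formula for the cosine then appears.\<close>

lemma projection_angle_add:
  assumes Q: "Q \<in> orthogonal_projections" and R: "R \<in> orthogonal_projections"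
    and nonneg: "0 \<le> \<alpha>" "0 \<le> \<beta>" and sum: "\<alpha> + \<beta> \<le> pi / 2"
    and x: "norm (x - blinfun_apply Q x) \<le> sin \<alpha> * norm x"
    and Qx: "norm (blinfun_apply Q x - blinfun_apply R (blinfun_apply Q x))
               \<le> sin \<beta> * norm (blinfun_apply Q x)"
  shows "norm (x - blinfun_apply R x) \<le> sin (\<alpha> + \<beta>) * norm x"
proof -
  define y where "y = Q x"
  define z where "z = R y"
  have cos_sin: "0 \<le> cos \<beta>" "0 \<le> sin \<beta>" "0 \<le> sin (\<alpha> + \<beta>)"
    using nonneg sum by (auto intro!: cos_ge_zero sin_ge_zero)
  have y: "cos \<alpha> * norm x \<le> norm y"
    unfolding y_def using nonneg sum by (intro projection_angle_bound_cos Q x) auto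
  have z: "cos \<beta> * norm y \<le> norm z"
    unfolding z_def using nonneg sum Qx by (intro projection_angle_bound_cos R) (auto simp: y_def)
  have "cos \<beta> * norm y - sin \<beta> * norm (x - y) \<le> norm (R x)"
  proof (cases "z = 0")
    \<comment> \<open>Here \<open>z\<close> forces \<open>cos \<beta> * norm y\<close> to be at most
      0, so the left-hand side is not positive.\<close>
    case True
    then show ?thesis
      using z mult_nonneg_nonneg[OF cos_sin(2) norm_ge_zero, of "x - y"]
        norm_ge_zero[of "blinfun_apply R x"] norm_zero by (metis diff_le_0_iff_le order_trans)
  next
    case False
    then have "y \<noteq> 0"
      by (auto simp: z_def)
    \<comment> \<open>This \<open>k\<close> makes \<open>k *\<^sub>R y\<close> the orthogonal
      projection of \<open>z\<close> onto the line through \<open>y\<close>, because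
      \<open>inner z y\<close> equals the squared norm of \<open>z\<close>. The remainder
      \<open>z - k *\<^sub>R y\<close> then has norm \<open>norm z\<close> times the sine of the
      angle between \<open>y\<close> and \<open>z\<close>.\<close>
    define k where "k = (norm z)\<^sup>2 / (norm y)\<^sup>2"
    have yz: "inner z y = (norm z)\<^sup>2"
      unfolding z_def by (rule projection_inner_self[OF R])
    have xy: "inner (x - y) y = 0"
      using projection_inner_self[OF Q, of x]
      by (simp add: y_def inner_diff power2_norm_eq_inner inner_commute)
    have "(norm (z - k *\<^sub>R y))\<^sup>2 = (norm z)\<^sup>2 - 2 * k * (norm z)\<^sup>2 + k\<^sup>2 * (norm y)\<^sup>2"
      using yz unfolding power2_norm_eq_inner
      by (simp add: inner_diff inner_commute power2_eq_square algebra_simps)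
    also have "\<dots> = (norm z)\<^sup>2 * ((norm y)\<^sup>2 - (norm z)\<^sup>2) / (norm y)\<^sup>2"
      using \<open>y \<noteq> 0\<close> by (simp add: k_def field_simps power2_eq_square)
    also have "(norm y)\<^sup>2 - (norm z)\<^sup>2 = (norm (y - z))\<^sup>2"
      using projection_pythagoras[OF R, of y] by (simp add: z_def)
    also have "(norm z)\<^sup>2 * (norm (y - z))\<^sup>2 / (norm y)\<^sup>2 \<le> (norm z)\<^sup>2 * (sin \<beta>)\<^sup>2"
    proof -
      have "(norm (y - z))\<^sup>2 \<le> (sin \<beta> * norm y)\<^sup>2"
        using Qx by (intro power_mono) (auto simp: y_def z_def)
      then show ?thesis
        using \<open>y \<noteq> 0\<close> by (simp add: divide_le_eq power_mult_distrib mult.assoc mult_left_mono)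
    qed
    finally have "(norm (z - k *\<^sub>R y))\<^sup>2 \<le> (norm z * sin \<beta>)\<^sup>2"
      by (simp add: power_mult_distrib)
    then have perp: "norm (z - k *\<^sub>R y) \<le> norm z * sin \<beta>"
      by (rule power2_le_imp_le) (simp add: cos_sin)
    have "inner (x - y) z = inner (x - y) (z - k *\<^sub>R y)"
      using xy by (simp add: inner_diff_right)
    then have "- inner (x - y) z \<le> norm (x - y) * norm (z - k *\<^sub>R y)"
      using Cauchy_Schwarz_ineq2[of "x - y" "z - k *\<^sub>R y"] by linarith
    also have "\<dots> \<le> norm (x - y) * (norm z * sin \<beta>)"
      by (intro mult_left_mono perp) auto
    finally have "(norm z)\<^sup>2 - norm (x - y) * (norm z * sin \<beta>) \<le> inner x z"
      using yz by (simp add: inner_diff inner_commute)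
    \<comment> \<open>\<open>R\<close> fixes \<open>z\<close> and is self-adjoint, so
      \<open>x\<close> may be replaced by \<open>R x\<close>; Cauchy-Schwarz and cancelling
      \<open>norm z\<close> give the lower bound for \<open>norm (R x)\<close>.\<close>
    also have "inner x z = inner (R x) z"
      by (simp add: projection_inner[OF R] z_def projection_idem[OF R])
    also have "\<dots> \<le> norm (R x) * norm z"
      by (rule norm_cauchy_schwarz)
    finally have "norm z * (norm z - sin \<beta> * norm (x - y)) \<le> norm z * norm (R x)"
      by (simp add: power2_eq_square algebra_simps)
    then have "norm z - sin \<beta> * norm (x - y) \<le> norm (R x)"
      using False by simp
    with z show ?thesis by linarith
  qed
  moreover have "cos \<beta> * (cos \<alpha> * norm x) \<le> cos \<beta> * norm y"
    using y cos_sin by (intro mult_left_mono) auto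
  moreover have "sin \<beta> * norm (x - y) \<le> sin \<beta> * (sin \<alpha> * norm x)"
    using x cos_sin by (intro mult_left_mono) (auto simp: y_def)
  ultimately have "cos (\<alpha> + \<beta>) * norm x \<le> norm (R x)"
    by (simp add: cos_add algebra_simps)
  \<comment> \<open>Squaring preserves the inequality only because this cosine is nonnegative, which
    is where the bound \<open>pi / 2\<close> on the sum of the angles enters.\<close>
  moreover have "0 \<le> cos (\<alpha> + \<beta>) * norm x"
    using nonneg sum by (auto intro!: mult_nonneg_nonneg cos_ge_zero)
  ultimately have "(cos (\<alpha> + \<beta>) * norm x)\<^sup>2 \<le> (norm (R x))\<^sup>2"
    by (rule power_mono)
  then have "(norm (x - R x))\<^sup>2 \<le> (sin (\<alpha> + \<beta>) * norm x)\<^sup>2"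
    using projection_pythagoras[OF R, of x]
    by (simp add: power_mult_distrib sin_squared_eq algebra_simps)
  then show ?thesis
    by (rule power2_le_imp_le) (simp add: cos_sin)
qed

text \<open>If the two angles add up to more than \<open>pi / 2\<close>, the upper bound of
  \<open>arcsin\<close> suffices. Otherwise angles are added in both directions, from the range of
  \<open>P\<close> to that of \<open>R\<close> via \<open>Q\<close> and back, and
  \<open>norm_projection_diff_le\<close> turns the two estimates into one for
  \<open>norm (P - R)\<close>.\<close>

lemma arcsin_norm_projection_triangle:
  assumes P: "P \<in> orthogonal_projections" and Q: "Q \<in> orthogonal_projections"
    and R: "R \<in> orthogonal_projections"
  shows "arcsin (norm (P - R)) \<le> arcsin (norm (P - Q)) + arcsin (norm (Q - R))"
proof -
  let ?\<alpha> = "arcsin (norm (P - Q))" and ?\<beta> = "arcsin (norm (Q - R))"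
  have le1: "norm (P - Q) \<le> 1" "norm (Q - R) \<le> 1" "norm (P - R) \<le> 1"
    by (simp_all add: norm_projection_diff_le_1 P Q R)
  have minus1: "- 1 \<le> norm A" for A :: "'a \<Rightarrow>\<^sub>L 'a"
    using norm_ge_zero[of A] by linarith
  have nonneg: "0 \<le> ?\<alpha>" "0 \<le> ?\<beta>"
    using le1 arcsin_le_arcsin[of 0] by force+
  show ?thesis
  proof (cases "?\<alpha> + ?\<beta> \<le> pi / 2")
    case True
    \<comment> \<open>For \<open>x\<close> in the range of \<open>A\<close>, the vector
      \<open>x - B x\<close> is \<open>(A - B) x\<close>.\<close>
    have range: "norm (x - blinfun_apply B x) \<le> norm (A - B) * norm x"
      if "blinfun_apply A x = x" for A B :: "'a \<Rightarrow>\<^sub>L 'a" and x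
      using norm_blinfun[of "A - B" x] that by (simp add: blinfun.diff_left)
    have sins: "sin ?\<alpha> = norm (P - Q)" "sin ?\<beta> = norm (Q - R)"
      using le1 minus1 by simp_all
    have "norm (P - R) \<le> sin (?\<alpha> + ?\<beta>)"
    proof (rule norm_projection_diff_le[OF P R])
      show "0 \<le> sin (?\<alpha> + ?\<beta>)"
        using nonneg True by (intro sin_ge_zero) auto
    next
      fix x assume "P x = x"
      then show "norm (x - R x) \<le> sin (?\<alpha> + ?\<beta>) * norm x"
        using nonneg True range[of P x Q] range[of Q "Q x" R] projection_idem[OF Q]
        by (intro projection_angle_add[OF Q R]) (auto simp: sins)
    next
      fix x assume "R x = x"
      then have "norm (x - P x) \<le> sin (?\<beta> + ?\<alpha>) * norm x"
        using nonneg True range[of R x Q] range[of Q "Q x" P] projection_idem[OF Q]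
        by (intro projection_angle_add[OF Q P])
          (auto simp: sins norm_minus_commute[of R] norm_minus_commute[of Q P])
      then show "norm (x - P x) \<le> sin (?\<alpha> + ?\<beta>) * norm x"
        by (simp add: add.commute)
    qed
    then have "arcsin (norm (P - R)) \<le> arcsin (sin (?\<alpha> + ?\<beta>))"
      by (intro arcsin_le_arcsin minus1 sin_le_one)
    also have "\<dots> = ?\<alpha> + ?\<beta>"
      using nonneg True by (intro arcsin_sin) auto
    finally show ?thesis .
  next
    case False
    moreover have "arcsin (norm (P - R)) \<le> pi / 2"
      by (intro arcsin_ubound minus1 le1)
    ultimately show ?thesis by linarith
  qed
qed

section \<open>Arc length\<close>

text \<open>The mean value inequality with the arc length from \<open>s\<close> as majorant. Only
  the real-valued speed is integrated, so the argument works in any normed space.\<close>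

lemma norm_increment_le_integral:
  fixes f :: "real \<Rightarrow> 'b::real_normed_vector"
  assumes "s \<le> t"
    and deriv: "\<And>u. u \<in> {s..t} \<Longrightarrow> (f has_vector_derivative f' u) (at u within {s..t})"
    and cont: "continuous_on {s..t} f'"
  shows "norm (f t - f s) \<le> integral {s..t} (\<lambda>u. norm (f' u))"
proof (cases "s = t")
  case False
  with \<open>s \<le> t\<close> have "s < t" by simp
  let ?L = "\<lambda>r. integral {s..r} (\<lambda>u. norm (f' u))"
  have L: "(?L has_vector_derivative norm (f' u)) (at u within {s..t})" if "u \<in> {s..t}" for u
    using cont that by (intro integral_has_vector_derivative continuous_intros)
  have "norm (f t - f s) \<le> ?L t - ?L s"
  proof (rule differentiable_bound_general[OF \<open>s < t\<close>])
    show "continuous_on {s..t} f"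
      by (rule continuous_on_vector_derivative) (rule deriv)
    show "continuous_on {s..t} ?L"
      by (rule continuous_on_vector_derivative) (rule L)
    fix u assume "s < u" "u < t"
    then show "(f has_vector_derivative f' u) (at u)"
      and "(?L has_vector_derivative norm (f' u)) (at u)"
      using deriv[of u] L[of u] by (simp_all add: at_within_Icc_at)
  qed simp
  then show ?thesis by simp
qed simp

text \<open>The bound is required on every subinterval so that it survives gluing at break points.
  It involves only integrals of \<open>h\<close>, so values of \<open>h\<close> at finitely many
  points do not matter.\<close>

definition speed_controls :: "(real \<Rightarrow> 'b::real_normed_vector) \<Rightarrow> (real \<Rightarrow> real) \<Rightarrow> real \<Rightarrow> real \<Rightarrow> bool"
  where "speed_controls f h c d \<longleftrightarrow> h integrable_on {c..d} \<and>
    (\<forall>s t. c \<le> s \<longrightarrow> s \<le> t \<longrightarrow> t \<le> d \<longrightarrow> norm (f t - f s) \<le> integral {s..t} h)"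

lemma speed_controls_combine:
  assumes "c \<le> d" "d \<le> e" and cd: "speed_controls f h c d" and de: "speed_controls f h d e"
  shows "speed_controls f h c e"
proof -
  have int: "h integrable_on {c..e}"
    using assms by (auto simp: speed_controls_def intro: Henstock_Kurzweil_Integration.integrable_combine)
  moreover have "norm (f t - f s) \<le> integral {s..t} h" if "c \<le> s" "s \<le> t" "t \<le> e" for s t
  proof -
    consider "t \<le> d" | "d \<le> s" | "s \<le> d" "d \<le> t" by linarith
    then show ?thesis
    proof cases
      case 3
      have "norm (f t - f s) \<le> norm (f d - f s) + norm (f t - f d)"
        by norm
      also have "\<dots> \<le> integral {s..d} h + integral {d..t} h"
        using 3 that cd de by (intro add_mono) (auto simp: speed_controls_def)
      also have "\<dots> = integral {s..t} h"
        using 3 that int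
        by (intro Henstock_Kurzweil_Integration.integral_combine)
          (auto elim: integrable_on_subinterval)
      finally show ?thesis .
    qed (use that cd de in \<open>auto simp: speed_controls_def\<close>)
  qed
  ultimately show ?thesis
    by (auto simp: speed_controls_def)
qed

lemma C1_smooth_speed_controls:
  assumes C1: "C1_smooth_on f {c..d}" and sub: "a \<le> c" "d \<le> b"
  shows "speed_controls f (\<lambda>t. norm (vector_derivative f (at t within {a..b}))) c d"
    (is "speed_controls f ?h c d")
proof -
  obtain f' where deriv: "\<And>t. t \<in> {c..d} \<Longrightarrow> (f has_vector_derivative f' t) (at t within {c..d})"
    and cont: "continuous_on {c..d} f'"
    using C1 unfolding C1_smooth_on_def by blast
  \<comment> \<open>Inside the piece, the derivatives within \<open>{c..d}\<close> and within
    \<open>{a..b}\<close> are both the two-sided one. At \<open>c\<close> and \<open>d\<close> they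
    may differ, or \<open>vector_derivative\<close> may be unspecified; these two points are
    negligible for the integral.\<close>
  have eq: "?h t = norm (f' t)" if "t \<in> {c..d} - {c, d}" for t
  proof -
    have "(f has_vector_derivative f' t) (at t)"
      using deriv[of t] that by (simp add: at_within_Icc_at)
    moreover have "at t within {a..b} = at t"
      using that sub by (intro at_within_Icc_at) auto
    ultimately show ?thesis
      by (simp add: vector_derivative_at)
  qed
  have "(\<lambda>t. norm (f' t)) integrable_on {c..d}"
    by (intro integrable_continuous_interval continuous_intros cont)
  then have "?h integrable_on {c..d}"
    by (rule integrable_spike_finite[of "{c, d}", rotated 2]) (use eq in auto)
  moreover have "norm (f t - f s) \<le> integral {s..t} ?h" if "c \<le> s" "s \<le> t" "t \<le> d" for s t
  proof -
    have "norm (f t - f s) \<le> integral {s..t} (\<lambda>u. norm (f' u))"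
    proof (rule norm_increment_le_integral[OF \<open>s \<le> t\<close>])
      show "continuous_on {s..t} f'"
        using that by (intro continuous_on_subset[OF cont]) auto
      show "(f has_vector_derivative f' u) (at u within {s..t})" if "u \<in> {s..t}" for u
        using that \<open>c \<le> s\<close> \<open>t \<le> d\<close>
        by (intro has_vector_derivative_within_subset[OF deriv]) auto
    qed
    also have "\<dots> = integral {s..t} ?h"
      using that eq by (intro integral_spike[of "{c, d}"]) auto
    finally show ?thesis .
  qed
  ultimately show ?thesis
    by (auto simp: speed_controls_def)
qed

lemma piecewise_C1_smooth_speed_controls:
  assumes "piecewise_C1_smooth a b f"
  shows "speed_controls f (\<lambda>t. norm (vector_derivative f (at t within {a..b}))) a b"
    (is "speed_controls f ?h a b")
proof -
  obtain n and t :: "nat \<Rightarrow> real" where t: "t 0 = a" "t n = b"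
    and step: "\<And>j. j < n \<Longrightarrow> t j < t (Suc j)"
    and C1: "\<And>j. j < n \<Longrightarrow> C1_smooth_on f {t j..t (Suc j)}"
    using assms unfolding piecewise_C1_smooth_def by blast
  have mono: "t i \<le> t j" if "i \<le> j" "j \<le> n" for i j
    using that by (induction j rule: dec_induct) (use step in \<open>auto intro: order_trans[OF _ less_imp_le[OF step]]\<close>)
  have "speed_controls f ?h a (t j)" if "j \<le> n" for j
    using that
  proof (induction j)
    case 0
    have "?h integrable_on {a..a}"
      using integrable_on_refl[of ?h a] by simp
    moreover have "norm (f t - f s) \<le> integral {s..t} ?h" if "a \<le> s" "s \<le> t" "t \<le> a" for s t
    proof -
      have "s = t"
        using that by simp
      then show ?thesis
        by simp
    qed
    ultimately show ?case
      by (auto simp: speed_controls_def t)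
  next
    case (Suc j)
    then have "speed_controls f ?h (t j) (t (Suc j))"
      using mono[of 0 j] mono[of "Suc j" n] t by (intro C1_smooth_speed_controls C1) auto
    moreover have "a \<le> t j" "t j \<le> t (Suc j)"
      using Suc.prems mono[of 0 j] step[of j] t by auto
    ultimately show ?case
      using Suc by (intro speed_controls_combine[of a "t j" "t (Suc j)"]) auto
  qed
  from this[of n] show ?thesis
    by (simp add: t)
qed

section \<open>From local to global estimates along the path\<close>

lemma increment_le_of_locally:
  fixes \<phi> L :: "real \<Rightarrow> real"
  assumes "a \<le> b" and cont: "continuous_on {a..b} L" and "0 < \<delta>"
    and step: "\<And>s t. \<lbrakk>a \<le> s; s \<le> t; t \<le> b; L t - L s < \<delta>\<rbrakk> \<Longrightarrow> \<phi> t - \<phi> s \<le> c * (L t - L s)"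
  shows "\<phi> b - \<phi> a \<le> c * (L b - L a)"
proof -
  \<comment> \<open>Uniform continuity yields one mesh size for which all increments of
    \<open>L\<close> stay below \<open>\<delta>\<close>; the estimates \<open>step\<close> on an
    equidistant partition then telescope.\<close>
  have "uniformly_continuous_on {a..b} L"
    by (rule compact_uniformly_continuous[OF cont compact_Icc])
  then obtain \<eta> where "\<eta> > 0"
    and \<eta>: "\<And>s t. \<lbrakk>s \<in> {a..b}; t \<in> {a..b}; dist t s < \<eta>\<rbrakk> \<Longrightarrow> dist (L t) (L s) < \<delta>"
    unfolding uniformly_continuous_on_def using \<open>0 < \<delta>\<close> by metis
  \<comment> \<open>The strict inequality makes the mesh smaller than \<open>\<eta>\<close> and
    gives \<open>N > 0\<close> even when \<open>a = b\<close>.\<close>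
  obtain N :: nat where N: "(b - a) / \<eta> < real N"
    using reals_Archimedean2 by blast
  have "N > 0"
    using N \<open>a \<le> b\<close> \<open>\<eta> > 0\<close> by (cases N) (auto simp: divide_less_0_iff)
  define p where "p i = a + real i * ((b - a) / real N)" for i
  have p: "p 0 = a" "p N = b" "\<And>i. p (Suc i) - p i = (b - a) / real N"
    using \<open>N > 0\<close> by (auto simp: p_def algebra_simps add_divide_distrib diff_divide_distrib)
  have h: "0 \<le> (b - a) / real N" "(b - a) / real N < \<eta>"
    using N \<open>N > 0\<close> \<open>\<eta> > 0\<close> \<open>a \<le> b\<close> by (auto simp: field_simps)
  have range: "p i \<in> {a..b}" if "i \<le> N" for i
  proof -
    have "real i * ((b - a) / real N) \<le> real N * ((b - a) / real N)"
      using that h by (intro mult_right_mono) auto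
    then show ?thesis
      using h(1) p(2) by (auto simp: p_def simp del: times_divide_eq_right)
  qed
  have "\<phi> (p i) - \<phi> a \<le> c * (L (p i) - L a)" if "i \<le> N" for i
    using that
  proof (induction i)
    case (Suc i)
    have i: "p i \<in> {a..b}" "p (Suc i) \<in> {a..b}"
      using Suc.prems by (auto intro: range simp del: atLeastAtMost_iff)
    have "dist (L (p (Suc i))) (L (p i)) < \<delta>"
      using p(3)[of i] h by (intro \<eta> i) (simp add: dist_real_def)
    then have "\<phi> (p (Suc i)) - \<phi> (p i) \<le> c * (L (p (Suc i)) - L (p i))"
      using i h unfolding p(3)[of i, symmetric] by (intro step) (auto simp: dist_real_def)
    then show ?case
      using Suc by (simp add: algebra_simps)
  qed (simp add: p)
  from this[of N] show ?thesis
    by (simp add: p)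
qed

text \<open>The derivative of \<open>arcsin\<close> at 0 is 1. Some excess \<epsilon> is
  unavoidable, since \<open>arcsin x > x\<close> for \<open>0 < x \<le> 1\<close>.\<close>

lemma arcsin_le_near_0:
  fixes \<epsilon> :: real
  assumes "0 < \<epsilon>"
  obtains \<delta> where "0 < \<delta>" "\<delta> \<le> 1" "\<And>x. \<lbrakk>0 \<le> x; x < \<delta>\<rbrakk> \<Longrightarrow> arcsin x \<le> (1 + \<epsilon>) * x"
proof -
  have "(arcsin has_derivative (\<lambda>x. x)) (at 0)"
    using DERIV_arcsin[of 0] by (simp add: has_field_derivative_def lambda_one)
  then obtain \<delta> where "0 < \<delta>"
    and \<delta>: "\<And>x. \<bar>x\<bar> < \<delta> \<Longrightarrow> \<bar>arcsin x - x\<bar> \<le> \<epsilon> * \<bar>x\<bar>"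
    using assms unfolding has_derivative_at_alt by auto
  show ?thesis
  proof
    show "0 < min \<delta> 1" "min \<delta> 1 \<le> 1"
      using \<open>0 < \<delta>\<close> by auto
    fix x :: real assume "0 \<le> x" "x < min \<delta> 1"
    then show "arcsin x \<le> (1 + \<epsilon>) * x"
      using \<delta>[of x] by (simp add: algebra_simps)
  qed
qed

theorem lemma3p4:
  fixes \<gamma> :: "real \<Rightarrow> ('a::chilbert_space \<Rightarrow>\<^sub>L 'a)" and a b :: real
  assumes separable: "separable_space (euclidean :: 'a topology)"
    and "a \<le> b"
    and "\<And>t. t \<in> {a..b} \<Longrightarrow> \<gamma> t \<in> orthogonal_projections"
    and "piecewise_C1_smooth a b \<gamma>"
  shows "arcsin (norm (\<gamma> b - \<gamma> a)) \<le> riemannian_length a b \<gamma>"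
proof -
  define h where "h t = norm (vector_derivative \<gamma> (at t within {a..b}))" for t
  define L where "L t = integral {a..t} h" for t
  \<comment> \<open>The angle from the initial projection, to be compared with the arc length
    \<open>L\<close>: by the triangle inequality its increments are at most the angle between
    \<open>\<gamma> s\<close> and \<open>\<gamma> t\<close>.\<close>
  define \<phi> where "\<phi> t = arcsin (norm (\<gamma> t - \<gamma> a))" for t
  have "speed_controls \<gamma> h a b"
    unfolding h_def by (rule piecewise_C1_smooth_speed_controls) fact
  then have int: "h integrable_on {a..b}"
    and bound: "\<And>s t. \<lbrakk>a \<le> s; s \<le> t; t \<le> b\<rbrakk> \<Longrightarrow> norm (\<gamma> t - \<gamma> s) \<le> integral {s..t} h"
    by (auto simp: speed_controls_def)
  have len: "riemannian_length a b \<gamma> = L b"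
    by (simp add: riemannian_length_def L_def h_def[abs_def])
  have increment: "integral {s..t} h = L t - L s" if "a \<le> s" "s \<le> t" "t \<le> b" for s t
    using Henstock_Kurzweil_Integration.integral_combine[of a s t h] that
      integrable_on_subinterval[OF int, of a t]
    by (auto simp: L_def)
  have L0: "L a = 0" and \<phi>0: "\<phi> a = 0"
    by (simp_all add: L_def \<phi>_def)
  have "\<phi> b \<le> (1 + \<epsilon>) * L b" if "0 < \<epsilon>" for \<epsilon>
  proof -
    obtain \<delta> where \<delta>: "0 < \<delta>" "\<delta> \<le> 1"
      and arcsin: "\<And>x. \<lbrakk>0 \<le> x; x < \<delta>\<rbrakk> \<Longrightarrow> arcsin x \<le> (1 + \<epsilon>) * x"
      using arcsin_le_near_0[OF \<open>0 < \<epsilon>\<close>] by blast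
    have "\<phi> b - \<phi> a \<le> (1 + \<epsilon>) * (L b - L a)"
    proof (rule increment_le_of_locally[OF \<open>a \<le> b\<close> _ \<open>0 < \<delta>\<close>])
      show "continuous_on {a..b} L"
        unfolding L_def by (rule indefinite_integral_continuous_1[OF int])
      fix s t assume st: "a \<le> s" "s \<le> t" "t \<le> b" and small: "L t - L s < \<delta>"
      let ?d = "norm (\<gamma> t - \<gamma> s)"
      have d: "?d \<le> L t - L s"
        using bound[OF st] increment[OF st] by simp
      have "\<phi> t \<le> arcsin ?d + \<phi> s"
        unfolding \<phi>_def using st assms(3) by (intro arcsin_norm_projection_triangle) auto
      moreover have "arcsin ?d \<le> (1 + \<epsilon>) * ?d"
        using d small by (intro arcsin) auto
      moreover have "(1 + \<epsilon>) * ?d \<le> (1 + \<epsilon>) * (L t - L s)"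
        using d \<open>0 < \<epsilon>\<close> by (intro mult_left_mono) auto
      ultimately show "\<phi> t - \<phi> s \<le> (1 + \<epsilon>) * (L t - L s)"
        by linarith
    qed
    then show ?thesis
      by (simp add: L0 \<phi>0)
  qed
  \<comment> \<open>The constant does not depend on the partition used for a given \<epsilon>, so
    letting \<epsilon> tend to 0 from the right removes the excess.\<close>
  moreover have "((\<lambda>\<epsilon>. (1 + \<epsilon>) * L b) \<longlongrightarrow> (1 + 0) * L b) (at_right 0)"
    by (intro tendsto_intros)
  ultimately have "\<phi> b \<le> (1 + 0) * L b"
    by (intro tendsto_lowerbound[of _ _ "at_right 0"])
      (auto simp: eventually_at_right_less elim!: eventually_mono[OF eventually_at_right_less])
  then show ?thesis
    by (simp add: len \<phi>_def)
qed

end
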